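(* Let $\mathcal{F}_m$ be the family of connected configurations in which the state of each node $v$ contains, for each incident edge $e$, an indication $I_v(e)\in\{\mathrm{True},\mathrm{False}\}$ of whether $e$ is marked at $v$, with at most one incident edge marked at each node. Let $\mathrm{MV}$ (Matching Verification) be the predicate which is true on such a configuration if and only if the set $M$ of marked edges is well defined, i.e. $I_v(e)=I_u(e)$ for every edge $e=(u,v)\in E$, and $M$ is a matching. Then the verification complexity of $(\mathcal{F}_m,\mathrm{MV})$ in the broadcast model (that is, in the $\mathrm{MCAST}(1)$ model) is $\Theta(\log\Delta)$, where $\Delta$ is the maximum degree of the underlying graph.
   Context: A configuration $G_s$ consists of a finite connected undirected graph $G=(V,E)$ and a state $s(v)$ for each node $v$; the state contains all local input, including a unique identifier $\mathrm{ID}(v)$. The edges incident to $v$ are numbered by ports $1,\dots,d(v)$, where $d(v)$ is the degree of $v$. Let $\mathcal{F}$ be a family of configurations and $\mathcal{P}$ a boolean predicate on $\mathcal{F}$; $G_s$ is legal if $\mathcal{P}(G_s)$ is true. A proof-labeling scheme (PLS) for $(\mathcal{F},\mathcal{P})$ is a pair (prover, verifier). Given a legal $G_s$, the prover assigns each node $v$ a label $\ell(v)$ (a bit string, of any length). The verifier is a distributed one-round algorithm: each node $v$, as a function of $s(v)$ and $\ell(v)$, sends a message (bit string) on each port, then, as a function of $s(v)$, $\ell(v)$ and the messages received on each of its ports, outputs True or False. A configuration with labels is accepted if all nodes output True, and otherwise rejected. Requirements: every legal $G_s$ with the prover's labels is accepted; every illegal $G_s\in\mathcal{F}$ is rejected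 for every label assignment. $\mathrm{MCAST}(r)$ model: each node partitions its neighbors into at most $r$ groups and sends the same message to all neighbors of a group (so at most $r$ distinct messages, an empty message counting as a message). $\mathrm{MCAST}(1)$ is the broadcast model. The verification complexity of a PLS is the maximal length of a message sent by the verifier under the prover's labels in legal configurations; that of a problem is the minimum over all PLSs for it in the given model. Here it is regarded as a function of $\Delta$: the family is restricted to configurations whose graph has maximum degree $\Delta$ (the scheme may depend on $\Delta$), and the worst case over legal configurations in the restricted family is taken. Constants hidden in $\Theta$ are universal; $\log x$ in upper bounds is read as $\max\{1,\log_2 x\}$, and the lower bound is for all sufficiently large $\Delta$. *)

theory Defs
  imports
    Complex_Main
    "HOL-Library.Extended_Nat"
    "HOL-Library.Extended_Real"
    "HOL-Library.Disjoint_Sets"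
    "Graph_Theory.Digraph_Component"
begin

type_synonym label = "bool list"
type_synonym message = "bool list"

record 'i node_state =
  ident :: nat
  input :: 'i

text \<open>
  The underlying graph is a symmetric loop-free digraph on natural numbers: the undirected edge
  \<open>{u, v}\<close> is the pair of arcs \<open>(u, v)\<close>, \<open>(v, u)\<close>. The names of the vertices are not visible to
  the nodes; what a node sees is its state. \<open>port C v u\<close> is the number of the edge \<open>{v, u}\<close>
  at its endpoint \<open>v\<close>.
\<close>

record 'i config =
  topo :: "nat pair_pre_digraph"
  port :: "nat \<Rightarrow> nat \<Rightarrow> nat"
  state :: "nat \<Rightarrow> 'i node_state"

abbreviation nodes :: "'i config \<Rightarrow> nat set" where
  "nodes C \<equiv> pverts (topo C)"

definition neighbors :: "'i config \<Rightarrow> nat \<Rightarrow> nat set" where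
  "neighbors C v = {u. (v, u) \<in> parcs (topo C)}"

definition deg :: "'i config \<Rightarrow> nat \<Rightarrow> nat" where
  "deg C v = card (neighbors C v)"

definition max_deg :: "'i config \<Rightarrow> nat" where
  "max_deg C = Max (deg C ` nodes C)"

definition configuration :: "'i config \<Rightarrow> bool" where
  "configuration C \<longleftrightarrow>
     pair_graph (topo C) \<and>
     Digraph_Component.connected (with_proj (topo C)) \<and>
     (\<forall>v\<in>nodes C. bij_betw (port C v) (neighbors C v) {1..deg C v}) \<and>
     inj_on (\<lambda>v. ident (state C v)) (nodes C)"

definition neighbor_at :: "'i config \<Rightarrow> nat \<Rightarrow> nat \<Rightarrow> nat" where
  "neighbor_at C v p = the_inv_into (neighbors C v) (port C v) p"

text \<open>
  \<open>send s l p\<close> is the message sent on port \<open>p\<close> by a node with state \<open>s\<close> and label \<open>l\<close>.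
  The list of messages given to \<open>decide\<close> is ordered by the ports \<open>1, \<dots>, d(v)\<close> of the receiver.
\<close>

record 'i verifier =
  send :: "'i node_state \<Rightarrow> label \<Rightarrow> nat \<Rightarrow> message"
  decide :: "'i node_state \<Rightarrow> label \<Rightarrow> message list \<Rightarrow> bool"

type_synonym 'i prover = "'i config \<Rightarrow> nat \<Rightarrow> label"

definition received :: "'i verifier \<Rightarrow> 'i config \<Rightarrow> (nat \<Rightarrow> label) \<Rightarrow> nat \<Rightarrow> message list" where
  "received ver C l v =
     map (\<lambda>p. let u = neighbor_at C v p in send ver (state C u) (l u) (port C u v))
       [1..<Suc (deg C v)]"

definition accepted :: "'i verifier \<Rightarrow> 'i config \<Rightarrow> (nat \<Rightarrow> label) \<Rightarrow> bool" where
  "accepted ver C l \<longleftrightarrow> (\<forall>v\<in>nodes C. decide ver (state C v) (l v) (received ver C l v))"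

definition pls :: "'i config set \<Rightarrow> ('i config \<Rightarrow> bool) \<Rightarrow> 'i prover \<times> 'i verifier \<Rightarrow> bool" where
  "pls F P S \<longleftrightarrow> (case S of (prv, ver) \<Rightarrow>
     (\<forall>C\<in>F. P C \<longrightarrow> accepted ver C (prv C)) \<and>
     (\<forall>C\<in>F. \<not> P C \<longrightarrow> (\<forall>l. \<not> accepted ver C l)))"

definition mcast :: "nat \<Rightarrow> 'i config set \<Rightarrow> 'i verifier \<Rightarrow> bool" where
  "mcast r F ver \<longleftrightarrow>
     (\<forall>C\<in>F. \<forall>v\<in>nodes C. \<forall>l. card (send ver (state C v) l ` {1..deg C v}) \<le> r)"

definition pls_complexity ::
    "'i config set \<Rightarrow> ('i config \<Rightarrow> bool) \<Rightarrow> 'i prover \<times> 'i verifier \<Rightarrow> enat" where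
  "pls_complexity F P S = (case S of (prv, ver) \<Rightarrow>
     (SUP C\<in>{C\<in>F. P C}. SUP v\<in>nodes C. SUP p\<in>{1..deg C v}.
        enat (length (send ver (state C v) (prv C v) p))))"

text \<open>
  Since \<open>enat\<close> is well-ordered, the infimum is a minimum as soon as some scheme exists;
  it is \<open>\<infinity>\<close> if there is no scheme or all of them have unbounded messages.
\<close>

definition verification_complexity ::
    "nat \<Rightarrow> 'i config set \<Rightarrow> ('i config \<Rightarrow> bool) \<Rightarrow> enat" where
  "verification_complexity r F P =
     (INF S\<in>{S. pls F P S \<and> mcast r F (snd S)}. pls_complexity F P S)"

definition with_max_deg :: "nat \<Rightarrow> 'i config set \<Rightarrow> 'i config set" where
  "with_max_deg \<Delta> F = {C\<in>F. max_deg C = \<Delta>}"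

text \<open>
  For matching verification the local input of \<open>v\<close> is the list of the indications for its
  incident edges in the order of the ports, so the edge at port \<open>p\<close> has list index \<open>p - 1\<close>.
  The family only bounds the number of edges marked at each node; whether the indications
  at the two endpoints of an edge agree is part of the predicate.
\<close>

definition marked :: "bool list config \<Rightarrow> nat \<Rightarrow> nat \<Rightarrow> bool" where
  "marked C v u \<longleftrightarrow> input (state C v) ! (port C v u - 1)"

definition F_m :: "bool list config set" where
  "F_m = {C. configuration C \<and>
     (\<forall>v\<in>nodes C. length (input (state C v)) = deg C v \<and>
        card {u\<in>neighbors C v. marked C v u} \<le> 1)}"

definition marked_edges :: "bool list config \<Rightarrow> nat set set" where
  "marked_edges C = {{u, v} | u v. (u, v) \<in> parcs (topo C) \<and> marked C u v}"

definition matching :: "nat set set \<Rightarrow> bool" where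
  "matching M \<longleftrightarrow> pairwise disjnt M"

definition MV :: "bool list config \<Rightarrow> bool" where
  "MV C \<longleftrightarrow>
     (\<forall>(u, v)\<in>parcs (topo C). marked C v u = marked C u v) \<and>
     matching (marked_edges C)"

end

theory Submission
  imports Defs "HOL-Combinatorics.Transposition"
begin

text \<open>
  Upper bound: colour the edges of the matching so that two of them joined by an edge get different
  colours. An edge of the matching is joined to at most \<open>2\<Delta>\<close> others, so \<open>O(log \<Delta>)\<close> bits suffice
  for greedy colouring. A matched node broadcasts the colour of its edge and accepts iff its partner
  is the only neighbour from which it receives this colour; an unmatched node broadcasts the empty
  string, which is not a colour. If \<open>v\<close> marks \<open>u\<close> and both accept, then \<open>u\<close> sends the colour of \<open>v\<close>,
  so \<open>u\<close> marks some \<open>w\<close>; as \<open>v\<close> sends the colour of \<open>u\<close>, \<open>w = v\<close>.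

  Lower bound: take \<open>K(n, n)\<close> with a perfect matching \<open>u\<^sub>i v\<^sub>i\<close>. If \<open>v\<^sub>i\<close> and \<open>v\<^sub>j\<close> broadcast the same
  message, exchanging the ports of \<open>u\<^sub>i\<close> towards \<open>v\<^sub>i\<close> and \<open>v\<^sub>j\<close> changes no view, but now \<open>u\<^sub>i\<close> marks
  \<open>v\<^sub>j\<close>, whose partner is \<open>u\<^sub>j\<close>. Hence the \<open>n\<close> messages of the \<open>v\<^sub>i\<close> are distinct.
\<close>

section \<open>Configurations and marks\<close>

lemma F_mD:
  assumes "C \<in> F_m"
  shows "configuration C"
    and "v \<in> nodes C \<Longrightarrow> length (input (state C v)) = deg C v"
    and "v \<in> nodes C \<Longrightarrow> card {u\<in>neighbors C v. marked C v u} \<le> 1"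
  using assms by (auto simp: F_m_def configuration_def)

lemma neighbors_subset_nodes:
  assumes "configuration C"
  shows "neighbors C v \<subseteq> nodes C"
proof -
  interpret pair_graph "topo C" using assms by (simp add: configuration_def)
  show ?thesis by (auto simp: neighbors_def dest: in_arcsD2)
qed

lemma finite_nodes: "configuration C \<Longrightarrow> finite (nodes C)"
  by (simp add: configuration_def pair_graph_def pair_digraph_def pair_fin_digraph_def
      pair_fin_digraph_axioms_def)

lemma finite_neighbors: "configuration C \<Longrightarrow> finite (neighbors C v)"
  using neighbors_subset_nodes finite_nodes finite_subset by metis

lemma neighbors_sym:
  assumes "configuration C"
  shows "u \<in> neighbors C v \<longleftrightarrow> v \<in> neighbors C u"
proof -
  interpret pair_graph "topo C" using assms by (simp add: configuration_def)
  show ?thesis by (auto simp: neighbors_def intro: arcs_symmetric)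
qed

lemma neighbors_irrefl:
  assumes "configuration C"
  shows "v \<notin> neighbors C v"
proof -
  interpret pair_graph "topo C" using assms by (simp add: configuration_def)
  show ?thesis using pair_no_loops[of "(v, v)"] by (auto simp: neighbors_def)
qed

lemma neighbor_of_node:
  assumes "configuration C" "u \<in> neighbors C v"
  shows "v \<in> nodes C" "u \<in> nodes C"
  using assms neighbors_sym neighbors_subset_nodes by blast+

lemma bij_betw_port:
  assumes "configuration C" "u \<in> neighbors C v"
  shows "bij_betw (port C v) (neighbors C v) {1..deg C v}"
  using assms(1) neighbor_of_node(1)[OF assms] by (simp add: configuration_def)

lemma port_range:
  assumes "configuration C" "u \<in> neighbors C v"
  shows "port C v u \<in> {1..deg C v}"
  using bij_betwE[OF bij_betw_port[OF assms]] assms(2) by blast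

lemma port_inj:
  assumes "configuration C" "u \<in> neighbors C v" "w \<in> neighbors C v" "port C v u = port C v w"
  shows "u = w"
  using bij_betw_port[OF assms(1,2)] assms by (meson bij_betw_imp_inj_on inj_onD)

lemma port_surj:
  assumes "configuration C" "v \<in> nodes C" "p < deg C v"
  obtains u where "u \<in> neighbors C v" "port C v u = Suc p"
proof -
  have "Suc p \<in> port C v ` neighbors C v"
    using assms by (auto simp: configuration_def bij_betw_def)
  then show thesis using that by auto
qed

lemma received_nth:
  assumes "configuration C" "u \<in> neighbors C v"
  shows "received ver C l v ! (port C v u - 1) = send ver (state C u) (l u) (port C u v)"
proof -
  have "inj_on (port C v) (neighbors C v)"
    using bij_betw_port[OF assms] by (rule bij_betw_imp_inj_on)
  then have "neighbor_at C v (port C v u) = u"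
    using assms by (simp add: neighbor_at_def the_inv_into_f_f)
  moreover obtain p where "port C v u = Suc p" "p < deg C v"
    using port_range[OF assms] by (cases "port C v u") auto
  ultimately show ?thesis by (simp add: received_def Let_def del: upt_Suc)
qed

lemma length_received [simp]: "length (received ver C l v) = deg C v"
  by (simp add: received_def)

lemma marked_unique:
  assumes "C \<in> F_m" "u \<in> neighbors C v" "w \<in> neighbors C v" "marked C v u" "marked C v w"
  shows "u = w"
proof -
  have "v \<in> nodes C" using assms F_mD neighbor_of_node by metis
  then have "card {u\<in>neighbors C v. marked C v u} \<le> Suc 0" using F_mD assms by auto
  moreover have "finite {u\<in>neighbors C v. marked C v u}"
    using finite_neighbors[OF F_mD(1)[OF assms(1)]] by auto
  ultimately show ?thesis using assms by (subst (asm) card_le_Suc0_iff_eq) auto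
qed

text \<open>A verifier sees indications by port, not neighbours. Since every port leads to a
  neighbour, its test for being matched agrees with \<open>marked\<close>.\<close>

lemma True_in_input_iff:
  assumes "C \<in> F_m" "v \<in> nodes C"
  shows "True \<in> set (input (state C v)) \<longleftrightarrow> (\<exists>u\<in>neighbors C v. marked C v u)"
proof
  assume "True \<in> set (input (state C v))"
  then obtain p where p: "p < deg C v" "input (state C v) ! p"
    using F_mD(2)[OF assms] by (auto simp: in_set_conv_nth)
  then obtain u where "u \<in> neighbors C v" "port C v u = Suc p"
    using port_surj F_mD(1) assms by metis
  then show "\<exists>u\<in>neighbors C v. marked C v u" using p by (force simp: marked_def)
next
  assume "\<exists>u\<in>neighbors C v. marked C v u"
  then obtain u where "u \<in> neighbors C v" "marked C v u" by auto
  then show "True \<in> set (input (state C v))"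
    using port_range[OF F_mD(1)[OF assms(1)], of u v] F_mD(2)[OF assms]
    by (auto simp: marked_def in_set_conv_nth intro!: exI[of _ "port C v u - 1"])
qed

text \<open>Once marks are symmetric, two marked edges sharing an endpoint \<open>x\<close> are both
  marked at \<open>x\<close>; a node of the family marks at most one edge, so they coincide.\<close>

lemma MV_iff_symmetric_marks:
  assumes "C \<in> F_m"
  shows "MV C \<longleftrightarrow> (\<forall>v. \<forall>u\<in>neighbors C v. marked C v u \<longrightarrow> marked C u v)"
proof
  assume "MV C"
  then show "\<forall>v. \<forall>u\<in>neighbors C v. marked C v u \<longrightarrow> marked C u v"
    by (auto simp: MV_def neighbors_def)
next
  assume sym: "\<forall>v. \<forall>u\<in>neighbors C v. marked C v u \<longrightarrow> marked C u v"
  have conf: "configuration C" using assms F_mD by auto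
  have edge: "\<exists>y. e = {x, y} \<and> y \<in> neighbors C x \<and> marked C x y"
    if "e \<in> marked_edges C" "x \<in> e" for e x
  proof -
    obtain u v where "e = {u, v}" "v \<in> neighbors C u" "marked C u v"
      using \<open>e \<in> marked_edges C\<close> by (auto simp: marked_edges_def neighbors_def)
    then show ?thesis using \<open>x \<in> e\<close> sym neighbors_sym[OF conf] by blast
  qed
  have "matching (marked_edges C)"
    unfolding matching_def pairwise_def disjnt_iff
    using edge marked_unique[OF assms] by metis
  moreover have "\<forall>(u, v)\<in>parcs (topo C). marked C v u = marked C u v"
  proof safe
    fix u v assume "(u, v) \<in> parcs (topo C)"
    then have "v \<in> neighbors C u" "u \<in> neighbors C v"
      using neighbors_sym[OF conf] by (auto simp: neighbors_def)
    then show "marked C u v \<Longrightarrow> marked C v u" "marked C v u \<Longrightarrow> marked C u v"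
      using sym by auto
  qed
  ultimately show "MV C" by (simp add: MV_def)
qed

section \<open>The colouring scheme\<close>

text \<open>Labels are arbitrary in an illegal configuration, so a matched node checks
  \<open>l \<noteq> []\<close>: otherwise a node that marks nothing could pass as a sender of the
  right colour.\<close>

definition colour_verifier :: "bool list verifier" where
  "colour_verifier = \<lparr>
     send = (\<lambda>s l p. if True \<in> set (input s) then l else []),
     decide = (\<lambda>s l ms. \<forall>p<length (input s). input s ! p \<longrightarrow>
       l \<noteq> [] \<and> ms ! p = l \<and> (\<forall>q<length ms. q \<noteq> p \<longrightarrow> ms ! q \<noteq> l))\<rparr>"

lemma mcast_colour_verifier: "mcast 1 F colour_verifier"
proof -
  have "card ((\<lambda>p. c) ` A) \<le> 1" for c :: message and A :: "nat set"
    by (cases "A = {}") (auto simp: image_constant_conv)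
  then show ?thesis by (simp add: mcast_def colour_verifier_def)
qed

definition colour_sent :: "bool list config \<Rightarrow> (nat \<Rightarrow> label) \<Rightarrow> nat \<Rightarrow> message" where
  "colour_sent C l v = (if \<exists>u\<in>neighbors C v. marked C v u then l v else [])"

text \<open>Ports biject with neighbours, so the quantifiers over list indices in
  \<open>decide\<close> turn into quantifiers over neighbours. Soundness and completeness work from
  this form and never touch ports.\<close>

lemma accepted_colour_verifier_iff:
  assumes "C \<in> F_m"
  shows "accepted colour_verifier C l \<longleftrightarrow>
    (\<forall>v\<in>nodes C. \<forall>u\<in>neighbors C v. marked C v u \<longrightarrow>
       l v \<noteq> [] \<and> colour_sent C l u = l v \<and> (\<forall>w\<in>neighbors C v. w \<noteq> u \<longrightarrow> colour_sent C l w \<noteq> l v))"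
proof -
  have conf: "configuration C" using assms F_mD by auto
  define ms where "ms = received colour_verifier C l"
  have nth: "ms v ! (port C v u - 1) = colour_sent C l u" if "u \<in> neighbors C v" for u v
    using received_nth[OF conf that] True_in_input_iff[OF assms neighbor_of_node(2)[OF conf that]]
    by (simp add: ms_def colour_verifier_def colour_sent_def)
  have all_port: "(\<forall>p<deg C v. Q p) \<longleftrightarrow> (\<forall>u\<in>neighbors C v. Q (port C v u - 1))"
    if v: "v \<in> nodes C" for v Q
  proof
    assume "\<forall>p<deg C v. Q p"
    then show "\<forall>u\<in>neighbors C v. Q (port C v u - 1)"
      using port_range[OF conf] by fastforce
  next
    assume "\<forall>u\<in>neighbors C v. Q (port C v u - 1)"
    then show "\<forall>p<deg C v. Q p" using port_surj[OF conf v] by (metis diff_Suc_1)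
  qed
  \<comment> \<open>Ports start at 1, so truncated subtraction loses nothing and distinct neighbours
    have distinct list indices.\<close>
  have port_eq: "port C v w - 1 = port C v u - 1 \<longleftrightarrow> w = u"
    if "u \<in> neighbors C v" "w \<in> neighbors C v" for u v w
    using port_range[OF conf that(1)] port_range[OF conf that(2)] port_inj[OF conf that] by force
  have "decide colour_verifier (state C v) (l v) (ms v) \<longleftrightarrow>
    (\<forall>u\<in>neighbors C v. marked C v u \<longrightarrow>
       l v \<noteq> [] \<and> colour_sent C l u = l v \<and> (\<forall>w\<in>neighbors C v. w \<noteq> u \<longrightarrow> colour_sent C l w \<noteq> l v))"
    if v: "v \<in> nodes C" for v
  proof -
    have "length (ms v) = deg C v" by (simp add: ms_def)
    then show ?thesis
      using F_mD(2)[OF assms v]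
      unfolding colour_verifier_def verifier.simps
      \<comment> \<open>The quantifiers are rewritten first; only then do the indices have the shape
        \<open>port C v u - 1\<close> that \<open>nth\<close> and \<open>port_eq\<close>
        expect.\<close>
      by (simp only: all_port[OF v]) (simp only: nth port_eq marked_def cong: ball_cong)
  qed
  then show ?thesis by (simp add: accepted_def ms_def)
qed

lemma colour_verifier_sound:
  assumes "C \<in> F_m" "accepted colour_verifier C l"
  shows "MV C"
  unfolding MV_iff_symmetric_marks[OF assms(1)]
proof (intro allI ballI impI)
  fix v u assume u: "u \<in> neighbors C v" "marked C v u"
  have conf: "configuration C" using assms F_mD by auto
  note acc = assms(2)[unfolded accepted_colour_verifier_iff[OF assms(1)], rule_format]
  have v: "v \<in> nodes C" "u \<in> nodes C" "v \<in> neighbors C u"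
    using neighbor_of_node[OF conf u(1)] neighbors_sym[OF conf] u by auto
  have "l v \<noteq> []" "colour_sent C l u = l v" using acc v u by auto
  then obtain w where w: "w \<in> neighbors C u" "marked C u w" and "l u = l v"
    by (auto simp: colour_sent_def split: if_splits)
  moreover have "colour_sent C l v = l v" using u by (auto simp: colour_sent_def)
  \<comment> \<open>\<open>u\<close> marks \<open>w\<close> and accepts, so no other neighbour may
    send \<open>l u\<close>; but \<open>v\<close> sends \<open>l v\<close>, which equals
    \<open>l u\<close>.\<close>
  ultimately have "w = v" using acc[OF v(2) w] v(3) by auto
  then show "marked C u v" using w by simp
qed

section \<open>Greedy colouring of the matching and the upper bound\<close>

lemma greedy_colouring:
  assumes "finite A"
    and "\<And>a b. R a b \<Longrightarrow> R b a"
    and "\<And>a. a \<in> A \<Longrightarrow> card {b\<in>A. R a b} < card S"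
  shows "\<exists>c. (\<forall>a\<in>A. c a \<in> S) \<and> (\<forall>a\<in>A. \<forall>b\<in>A. R a b \<longrightarrow> a \<noteq> b \<longrightarrow> c a \<noteq> c b)"
  \<comment> \<open>The degree bound depends on \<open>A\<close>, so it joins the induction;
    symmetry of \<open>R\<close> does not.\<close>
  using assms(1,3)
proof (induction A rule: finite_induct)
  case empty
  then show ?case by simp
next
  case (insert x A)
  have "card {b\<in>A. R a b} < card S" if "a \<in> A" for a
  proof -
    have "card {b\<in>A. R a b} \<le> card {b\<in>insert x A. R a b}"
      using insert.hyps by (intro card_mono) auto
    then show ?thesis using insert.prems[of a] that by simp
  qed
  then obtain c where c: "\<forall>a\<in>A. c a \<in> S" "\<forall>a\<in>A. \<forall>b\<in>A. R a b \<longrightarrow> a \<noteq> b \<longrightarrow> c a \<noteq> c b"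
    using insert.IH by blast
  have "card (c ` {b\<in>A. R x b}) \<le> card {b\<in>insert x A. R x b}"
    using insert.hyps card_image_le[of "{b\<in>A. R x b}" c]
    by (intro order_trans[OF card_image_le] card_mono) auto
  then have "card (c ` {b\<in>A. R x b}) < card S" using insert.prems[of x] by simp
  \<comment> \<open>The colours of earlier elements related to \<open>x\<close> are fewer than those
    of \<open>S\<close>, so one is left for \<open>x\<close>.\<close>
  then have "\<not> S \<subseteq> c ` {b\<in>A. R x b}"
    using insert.hyps by (metis (no_types, lifting) card_mono finite_imageI finite_Collect_conjI
        finite_subset linorder_not_le mem_Collect_eq subsetI)
  then obtain s where "s \<in> S" "s \<notin> c ` {b\<in>A. R x b}" by blast
  then have "(\<forall>a\<in>insert x A. (c(x := s)) a \<in> S) \<and> (\<forall>a\<in>insert x A. \<forall>b\<in>insert x A.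
    R a b \<longrightarrow> a \<noteq> b \<longrightarrow> (c(x := s)) a \<noteq> (c(x := s)) b)"
    using c insert.hyps assms(2) by auto
  then show ?case by blast
qed

lemma deg_le_max_deg:
  assumes "configuration C" "v \<in> nodes C"
  shows "deg C v \<le> max_deg C"
  using assms(2) finite_nodes[OF assms(1)] by (auto simp: max_deg_def)

lemma colour_verifier_complete:
  assumes C: "C \<in> F_m" and "MV C" and k: "2 * max_deg C < 2 ^ k" "0 < k"
  shows "\<exists>l. (\<forall>v. length (l v) = k) \<and> accepted colour_verifier C l"
proof -
  have conf: "configuration C" using C F_mD by auto
  note sym = \<open>MV C\<close>[unfolded MV_iff_symmetric_marks[OF C], rule_format]
  define M where "M = marked_edges C"
  \<comment> \<open>Conflict of two edges. Every edge of \<open>M\<close> conflicts with itself, so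
    the count below includes \<open>e\<close>; the colouring only separates distinct edges.\<close>
  define R where "R e f \<longleftrightarrow> (\<exists>x\<in>e. \<exists>y\<in>f. y \<in> neighbors C x)" for e f
  \<comment> \<open>Unique for a matched node because \<open>M\<close> is a matching; unspecified
    for the other nodes, which is why \<open>l\<close> below has a default.\<close>
  define edge_at where "edge_at y = (THE e. e \<in> M \<and> y \<in> e)" for y
  have M: "{u, v} \<in> M" if "v \<in> neighbors C u" "marked C u v" for u v
    using that by (auto simp: M_def marked_edges_def neighbors_def)
  have edge_at: "edge_at y = e" if "e \<in> M" "y \<in> e" for e y
    unfolding edge_at_def
  proof (rule the_equality)
    fix f assume "f \<in> M \<and> y \<in> f"
    then show "f = e" using that \<open>MV C\<close>
      by (auto simp: MV_def matching_def M_def pairwise_def disjnt_iff)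
  qed (use that in simp)
  have finM: "finite M"
  proof (rule finite_subset)
    show "M \<subseteq> Pow (nodes C)"
      using neighbor_of_node[OF conf] by (auto simp: M_def marked_edges_def neighbors_def)
  qed (use finite_nodes[OF conf] in simp)
  define S :: "label set" where "S = {l. length l = k}"
  have S: "card S = 2 ^ k"
    using card_lists_length_eq[of "UNIV :: bool set" k] by (simp add: S_def card_UNIV_bool)
  have "card {f\<in>M. R e f} < card S" if "e \<in> M" for e
  proof -
    obtain u v where e: "e = {u, v}" and uv: "v \<in> neighbors C u"
      using \<open>e \<in> M\<close> by (auto simp: M_def marked_edges_def neighbors_def)
    \<comment> \<open>An edge in conflict with \<open>e\<close> contains a neighbour
      \<open>y\<close> of \<open>u\<close> or \<open>v\<close> and is recovered from it as
      \<open>edge_at y\<close>. This gives the bound \<open>2 * max_deg C\<close>.\<close>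
    have "{f\<in>M. R e f} \<subseteq> edge_at ` (neighbors C u \<union> neighbors C v)"
    proof
      fix f assume "f \<in> {f\<in>M. R e f}"
      then obtain y where "f \<in> M" "y \<in> f" "y \<in> neighbors C u \<union> neighbors C v"
        by (auto simp: R_def e)
      then show "f \<in> edge_at ` (neighbors C u \<union> neighbors C v)"
        using edge_at by blast
    qed
    then have "card {f\<in>M. R e f} \<le> card (neighbors C u \<union> neighbors C v)"
      using finite_neighbors[OF conf] by (intro surj_card_le) auto
    also have "\<dots> \<le> deg C u + deg C v" by (simp add: deg_def card_Un_le)
    also have "\<dots> \<le> 2 * max_deg C"
      using deg_le_max_deg[OF conf] neighbor_of_node[OF conf uv] by (simp add: add_mono mult_2)
    finally show ?thesis using k S by simp
  qed
  moreover have "R f e" if "R e f" for e f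
    using that neighbors_sym[OF conf] by (auto simp: R_def)
  ultimately obtain c where c: "\<forall>e\<in>M. c e \<in> S"
      "\<forall>e\<in>M. \<forall>f\<in>M. R e f \<longrightarrow> e \<noteq> f \<longrightarrow> c e \<noteq> c f"
    using greedy_colouring[OF finM, of R S] by blast
  \<comment> \<open>The default label is never broadcast; it keeps all labels at length
    \<open>k\<close>.\<close>
  define l where "l v = (if edge_at v \<in> M then c (edge_at v) else replicate k False)" for v
  have l: "l v = c e" if "e \<in> M" "v \<in> e" for v e
    using edge_at[OF that] that by (simp add: l_def)
  have len: "length (l v) = k" for v using c(1) by (auto simp: l_def S_def)
  have "accepted colour_verifier C l"
    unfolding accepted_colour_verifier_iff[OF C]
  proof (intro ballI impI conjI)
    fix v u assume vu: "v \<in> nodes C" "u \<in> neighbors C v" "marked C v u"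
    have vM: "{v, u} \<in> M" using M vu by auto
    show "l v \<noteq> []" using len[of v] k by auto
    show "colour_sent C l u = l v"
      using l[OF vM] sym[OF vu(2,3)] neighbors_sym[OF conf] vu
      by (auto simp: colour_sent_def)
    fix w assume w: "w \<in> neighbors C v" "w \<noteq> u"
    show "colour_sent C l w \<noteq> l v"
    proof (cases "\<exists>x\<in>neighbors C w. marked C w x")
      case True
      then obtain x where x: "x \<in> neighbors C w" "marked C w x" by auto
      then have wM: "{w, x} \<in> M" using M by auto
      have "w \<noteq> v" using w neighbors_irrefl[OF conf] by auto
      then have "{v, u} \<noteq> {w, x}" using w by auto
      moreover have "R {v, u} {w, x}" using w by (auto simp: R_def)
      ultimately have "c {v, u} \<noteq> c {w, x}" using c(2) vM wM by blast
      then show ?thesis using True l[OF vM] l[OF wM] by (auto simp: colour_sent_def)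
    next
      case False
      \<comment> \<open>Here \<open>w\<close> sends the empty string, while \<open>l v\<close> has
        length \<open>k > 0\<close>.\<close>
      then show ?thesis using len[of v] k by (auto simp: colour_sent_def)
    qed
  qed
  then show ?thesis using len by blast
qed

lemma verification_complexity_le:
  assumes k: "2 * \<Delta> < 2 ^ k" "0 < k"
  shows "verification_complexity 1 (with_max_deg \<Delta> F_m) MV \<le> enat k"
proof -
  define prv where
    "prv C = (SOME l. (\<forall>v. length (l v) = k) \<and> accepted colour_verifier C l)" for C
  have prv: "length (prv C v) = k" "accepted colour_verifier C (prv C)"
    if "C \<in> with_max_deg \<Delta> F_m" "MV C" for C v
  proof -
    have "C \<in> F_m" "2 * max_deg C < 2 ^ k" using that k by (auto simp: with_max_deg_def)
    from someI_ex[OF colour_verifier_complete[OF this(1) that(2) this(2) k(2)]]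
    show "length (prv C v) = k" "accepted colour_verifier C (prv C)"
      by (auto simp: prv_def)
  qed
  have "pls (with_max_deg \<Delta> F_m) MV (prv, colour_verifier)"
    using prv colour_verifier_sound by (auto simp: pls_def with_max_deg_def)
  then have "verification_complexity 1 (with_max_deg \<Delta> F_m) MV
    \<le> pls_complexity (with_max_deg \<Delta> F_m) MV (prv, colour_verifier)"
    using mcast_colour_verifier unfolding verification_complexity_def by (intro INF_lower) auto
  also have "\<dots> \<le> enat k"
    unfolding pls_complexity_def prod.case
    by (intro SUP_least) (auto simp: prv colour_verifier_def)
  finally show ?thesis .
qed

text \<open>With \<open>2 ^ n\<close> the largest power of two not exceeding a positive
  \<open>\<Delta>\<close>, \<open>k = n + 2\<close> works: \<open>n \<le> log 2 \<Delta>\<close>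
  gives \<open>n + 2 \<le> 3 * max 1 (log 2 \<Delta>)\<close>.\<close>

lemma ex_colour_length:
  "\<exists>k>0. 2 * \<Delta> < 2 ^ k \<and> real k \<le> 3 * max 1 (log 2 (real \<Delta>))"
proof (cases "\<Delta> = 0")
  case True
  then show ?thesis by (intro exI[of _ 1]) auto
next
  case False
  then obtain n where n: "2 ^ n \<le> \<Delta>" "\<Delta> < 2 ^ (n + 1)"
    using ex_power_ivl1[of 2 \<Delta>] by auto
  then have "real n \<le> log 2 (real \<Delta>)"
    using False by (simp add: le_log_iff powr_realpow)
  then show ?thesis using n by (intro exI[of _ "n + 2"]) auto
qed

section \<open>Complete bipartite configurations\<close>

text \<open>
  The sides of \<open>K(n, n)\<close> are \<open>{..<n}\<close> and \<open>{n..<2n}\<close>; \<open>v mod n\<close> is the index of a node in its side.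
  Node \<open>v\<close> marks port \<open>v mod n + 1\<close>, and \<open>q v\<close> permutes its ports: the edge to the neighbour of
  index \<open>i\<close> has port \<open>q v i + 1\<close>.
\<close>

definition biclique :: "nat \<Rightarrow> (nat \<Rightarrow> nat \<Rightarrow> nat) \<Rightarrow> bool list config" where
  "biclique n q = \<lparr>
     topo = \<lparr>pverts = {..<2 * n}, parcs = {(u, v). u < 2 * n \<and> v < 2 * n \<and> (u < n \<longleftrightarrow> \<not> v < n)}\<rparr>,
     port = (\<lambda>v u. Suc (q v (u mod n))),
     state = (\<lambda>v. \<lparr>ident = v, input = map (\<lambda>p. p = v mod n) [0..<n]\<rparr>)\<rparr>"

lemma biclique_simps [simp]:
  "nodes (biclique n q) = {..<2 * n}"
  "port (biclique n q) v u = Suc (q v (u mod n))"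
  "ident (state (biclique n q) v) = v"
  "input (state (biclique n q) v) = map (\<lambda>p. p = v mod n) [0..<n]"
  by (auto simp: biclique_def)

lemma state_biclique: "state (biclique n q) = state (biclique n q')"
  by (simp add: biclique_def)

lemma neighbors_biclique:
  assumes "v < 2 * n"
  shows "neighbors (biclique n q) v = (if v < n then {n..<2 * n} else {..<n})"
  using assms by (auto simp: neighbors_def biclique_def)

lemma bij_betw_mod_side:
  "bij_betw (\<lambda>u. u mod n) (if v < n then {n..<2 * n} else {..<n}) {..<(n::nat)}"
proof (cases "v < n")
  case True
  have "bij_betw (\<lambda>u. u mod n) {n..<2 * n} {..<n}"
    by (intro bij_betw_byWitness[where f' = "\<lambda>i. i + n"]) (auto simp: mod_if)
  then show ?thesis using True by simp
next
  case False
  have "bij_betw (\<lambda>u. u mod n) {..<n} {..<n}"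
    by (intro bij_betw_byWitness[where f' = "\<lambda>i. i"]) auto
  then show ?thesis using False by simp
qed

lemma deg_biclique: "v < 2 * n \<Longrightarrow> deg (biclique n q) v = n"
  by (simp add: deg_def neighbors_biclique)

lemma marked_biclique:
  assumes "v < 2 * n" "u \<in> neighbors (biclique n q) v" "bij_betw (q v) {..<n} {..<n}"
  shows "marked (biclique n q) v u \<longleftrightarrow> q v (u mod n) = v mod n"
proof -
  have "q v (u mod n) < n" using assms by (auto dest!: bij_betwE)
  then show ?thesis by (simp add: marked_def)
qed

lemma configuration_biclique:
  assumes n: "0 < n" and q: "\<And>v. bij_betw (q v) {..<n} {..<n}"
  shows "configuration (biclique n q)"
proof -
  let ?C = "biclique n q"
  have graph: "pair_graph (topo ?C)"
    by unfold_locales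
      (auto simp: biclique_def symmetric_def sym_def
        intro: finite_subset[of _ "{..<2 * n} \<times> {..<2 * n}"])
  then interpret pair_graph "topo ?C" .
  have arc: "(u, v) \<in> parcs (topo ?C) \<longleftrightarrow> u < 2 * n \<and> v < 2 * n \<and> (u < n \<longleftrightarrow> \<not> v < n)" for u v
    by (simp add: biclique_def)
  have step: "u \<rightarrow>\<^sup>*\<^bsub>with_proj (topo ?C)\<^esub> v" if "(u, v) \<in> parcs (topo ?C)" for u v
    using that by (simp add: reachable_adjI)
  have "u \<rightarrow>\<^sup>*\<^bsub>with_proj (topo ?C)\<^esub> v" if "u < 2 * n" "v < 2 * n" for u v
  proof (cases "u < n \<longleftrightarrow> v < n")
    case True
    \<comment> \<open>Nodes of the same side are connected through the node of index 0 on the other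
      side.\<close>
    define w where "w = (if u < n then n else 0)"
    have "(u, w) \<in> parcs (topo ?C)" "(w, v) \<in> parcs (topo ?C)"
      using n True that by (auto simp: arc w_def)
    then show ?thesis using step reachable_trans by blast
  next
    case False
    then show ?thesis using step that by (auto simp: arc)
  qed
  then have "Digraph_Component.connected (with_proj (topo ?C))"
    unfolding Digraph_Component.connected_def
    using n by (intro strongly_connectedI) (auto intro!: reachable_mk_symmetricI simp: lessThan_empty_iff)
  moreover have "bij_betw (port ?C v) (neighbors ?C v) {1..deg ?C v}" if "v < 2 * n" for v
  proof -
    have "bij_betw Suc {..<n} {1..n}"
      by (metis bij_betw_Suc image_Suc_lessThan bij_betw_def inj_Suc inj_on_subset subset_UNIV)
    then have "bij_betw (Suc \<circ> (q v \<circ> (\<lambda>u. u mod n))) (neighbors ?C v) {1..n}"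
      unfolding neighbors_biclique[OF that]
      by (intro bij_betw_trans[OF bij_betw_trans[OF bij_betw_mod_side q]])
    moreover have "port ?C v = Suc \<circ> (q v \<circ> (\<lambda>u. u mod n))" by auto
    ultimately show ?thesis using that by (simp add: deg_biclique)
  qed
  ultimately show ?thesis
    using graph by (auto simp: configuration_def inj_on_def)
qed

text \<open>This covers every choice of port permutations, including those with inconsistent marks:
  the marked port of \<open>v\<close> is always \<open>v mod n + 1\<close>, and it leads to a single
  neighbour.\<close>

lemma biclique_in_family:
  assumes n: "0 < n" and q: "\<And>v. bij_betw (q v) {..<n} {..<n}"
  shows "biclique n q \<in> with_max_deg n F_m"
proof -
  let ?C = "biclique n q"
  have "deg ?C ` nodes ?C = {n}"
    using n by (auto simp: deg_biclique image_def intro: exI[of _ 0])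
  then have "max_deg ?C = n" by (simp add: max_deg_def)
  moreover have "card {u\<in>neighbors ?C v. marked ?C v u} \<le> 1" if v: "v < 2 * n" for v
  proof -
    have "u = w" if "u \<in> neighbors ?C v" "w \<in> neighbors ?C v" "marked ?C v u" "marked ?C v w" for u w
    proof -
      have "port ?C v u = port ?C v w" using that v q by (simp add: marked_biclique)
      then show ?thesis using port_inj[OF configuration_biclique[OF n q] that(1,2)] by simp
    qed
    moreover have "finite {u\<in>neighbors ?C v. marked ?C v u}"
      using finite_neighbors[OF configuration_biclique[OF n q]] by auto
    ultimately show ?thesis unfolding One_nat_def by (subst card_le_Suc0_iff_eq) auto
  qed
  ultimately show ?thesis
    using configuration_biclique[OF n q] by (auto simp: with_max_deg_def F_m_def deg_biclique)
qed

section \<open>Exchange of two ports in the biclique\<close>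

lemma biclique_marks_distinct_messages:
  assumes n: "0 < n" and pls: "pls (with_max_deg n F_m) MV (prv, ver)"
    and mcast: "mcast 1 (with_max_deg n F_m) ver"
  defines "C \<equiv> biclique n (\<lambda>v. id)"
  shows "MV C" "inj_on (\<lambda>i. send ver (state C (n + i)) (prv C (n + i)) 1) {..<n}"
proof -
  have CF: "C \<in> with_max_deg n F_m"
    unfolding C_def using n by (intro biclique_in_family) auto
  then have "C \<in> F_m" by (simp add: with_max_deg_def)
  then have conf: "configuration C" by (rule F_mD)
  have marked: "marked C v u \<longleftrightarrow> u mod n = v mod n" if "u \<in> neighbors C v" for u v
    using that neighbor_of_node(1)[OF conf that] by (simp add: C_def marked_biclique)
  show legal: "MV C"
    unfolding MV_iff_symmetric_marks[OF \<open>C \<in> F_m\<close>]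
  proof (intro allI ballI impI)
    fix v u assume "u \<in> neighbors C v" "marked C v u"
    moreover from this have "v \<in> neighbors C u" using neighbors_sym[OF conf] by blast
    ultimately show "marked C u v" by (simp only: marked)
  qed
  \<comment> \<open>Broadcasting makes the message of a node independent of the port. Port 1,
    present since \<open>n > 0\<close>, stands for all of them, and renumbering ports cannot change
    what is sent.\<close>
  define m where "m v = send ver (state C v) (prv C v) 1" for v
  have broadcast: "send ver (state C v) (prv C v) p = m v" if "v < 2 * n" "p \<in> {1..n}" for v p
  proof -
    have deg: "deg C v = n" using that by (simp add: C_def deg_biclique)
    have "card (send ver (state C v) (prv C v) ` {1..deg C v}) \<le> Suc 0"
      using mcast CF that by (auto simp: mcast_def C_def)
    then have "\<forall>a\<in>{1..n}. \<forall>b\<in>{1..n}. send ver (state C v) (prv C v) a = send ver (state C v) (prv C v) b"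
      unfolding deg by (subst (asm) card_le_Suc0_iff_eq) (simp, blast)
    moreover have "1 \<in> {1..n}" using n by simp
    ultimately show ?thesis using that(2) unfolding m_def by blast
  qed
  have acc: "accepted ver C (prv C)" using pls CF legal by (auto simp: pls_def)
  have "i = j" if ij: "i < n" "j < n" "m (n + i) = m (n + j)" for i j
  proof (rule ccontr)
    assume "i \<noteq> j"
    \<comment> \<open>The exchange happens at \<open>i\<close> alone. Indications are listed by
      port, so the states stay as they were while two ports lead elsewhere.\<close>
    define q where "q v = (if v = i then transpose i j else id)" for v
    define C' where "C' = biclique n q"
    have q: "bij_betw (q v) {..<n} {..<n}" for v
      using ij by (auto simp: q_def bij_betw_transpose_iff)
    have C'F: "C' \<in> with_max_deg n F_m"
      unfolding C'_def using n q by (intro biclique_in_family) auto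
    have st: "state C' = state C" unfolding C_def C'_def by (rule state_biclique)
    have "received ver C' (prv C) v = received ver C (prv C) v" if v: "v < 2 * n" for v
    proof (rule nth_equalityI)
      show "length (received ver C' (prv C) v) = length (received ver C (prv C) v)"
        using v by (simp add: C_def C'_def deg_biclique)
      fix p assume "p < length (received ver C' (prv C) v)"
      then have p: "p < n" using v by (simp add: C'_def deg_biclique)
      have conf: "configuration C" "configuration C'"
        using F_mD(1) CF C'F unfolding with_max_deg_def by blast+
      obtain u where u: "u \<in> neighbors C v" "port C v u = Suc p"
        using port_surj[OF conf(1), of v p] v p by (auto simp: C_def deg_biclique)
      obtain u' where u': "u' \<in> neighbors C' v" "port C' v u' = Suc p"
        using port_surj[OF conf(2), of v p] v p by (auto simp: C'_def deg_biclique)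
      have lt: "u < 2 * n" "u' < 2 * n"
        using neighbor_of_node[OF conf(1) u(1)] neighbor_of_node[OF conf(2) u'(1)]
        by (auto simp: C_def C'_def)
      have rec: "received ver C (prv C) v ! p = m u"
      proof -
        have "port C u v \<in> {1..n}"
          using port_range[OF conf(1), of v u] neighbors_sym[OF conf(1)] u(1) lt
          by (auto simp: C_def deg_biclique)
        then show ?thesis
          using received_nth[OF conf(1) u(1), of ver "prv C"] u(2) broadcast lt by simp
      qed
      have rec': "received ver C' (prv C) v ! p = m u'"
      proof -
        have "port C' u' v \<in> {1..n}"
          using port_range[OF conf(2), of v u'] neighbors_sym[OF conf(2)] u'(1) lt
          by (auto simp: C'_def deg_biclique)
        then show ?thesis
          using received_nth[OF conf(2) u'(1), of ver "prv C"] u'(2) broadcast lt st by simp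
      qed
      \<comment> \<open>Node \<open>i\<close> now hears \<open>n + j\<close> where it heard
        \<open>n + i\<close> and conversely, and these two send the same message; every other port
        in the graph leads to its old neighbour.\<close>
      have "m u' = m u"
      proof (cases "v = i")
        case True
        then have "u \<in> {n..<2 * n}" "u' \<in> {n..<2 * n}"
          using u(1) u'(1) v ij by (auto simp: C_def C'_def neighbors_biclique)
        moreover have "x = n + x mod n" if "x \<in> {n..<2 * n}" for x
        proof -
          have "(x - n) mod n = x - n" using that by (intro mod_less) auto
          then show ?thesis using that by (simp add: le_mod_geq)
        qed
        ultimately have "u = n + u mod n" "u' = n + u' mod n" by blast+
        moreover have "u mod n = p" "transpose i j (u' mod n) = p"
          using u(2) u'(2) True by (auto simp: C_def C'_def q_def)
        ultimately show ?thesis using ij(3)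
          by (auto simp: transpose_def split: if_splits)
      next
        case False
        then have "port C v u' = port C v u" "u' \<in> neighbors C v"
          using u'(1,2) u v by (auto simp: C_def C'_def q_def neighbors_biclique)
        then show ?thesis using port_inj[OF conf(1)] u(1) by blast
      qed
      then show "received ver C' (prv C) v ! p = received ver C (prv C) v ! p"
        using rec rec' by simp
    qed
    then have "accepted ver C' (prv C)"
      using acc st by (auto simp: accepted_def C_def C'_def)
    then have "MV C'" using pls C'F by (auto simp: pls_def)
    then have sym: "\<forall>v. \<forall>u\<in>neighbors C' v. marked C' v u \<longrightarrow> marked C' u v"
      using C'F by (simp add: MV_iff_symmetric_marks with_max_deg_def)
    have nb: "n + j \<in> neighbors C' i" "i \<in> neighbors C' (n + j)"
      using ij by (auto simp: C'_def neighbors_biclique)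
    \<comment> \<open>\<open>i\<close> still marks port \<open>i + 1\<close>, which now leads to
      \<open>n + j\<close>; but \<open>n + j\<close> marks its edge to \<open>j\<close>.\<close>
    then have "marked C' i (n + j)" "\<not> marked C' (n + j) i"
      using ij q \<open>i \<noteq> j\<close> by (auto simp: C'_def marked_biclique) (auto simp: q_def)
    then show False using sym nb by blast
  qed
  then show "inj_on (\<lambda>i. send ver (state C (n + i)) (prv C (n + i)) 1) {..<n}"
    by (auto simp: inj_on_def m_def)
qed

section \<open>Counting short messages\<close>

lemma card_lists_length_le_bool: "card {l :: bool list. length l \<le> L} < 2 ^ (L + 1)"
proof -
  have "card {l :: bool list. length l \<le> L} = (\<Sum>i\<le>L. 2 ^ i)"
    using card_lists_length_le[of "UNIV :: bool set" L] by (simp add: card_UNIV_bool)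
  also have "\<dots> < 2 ^ (L + 1)"
    by (induction L) auto
  finally show ?thesis .
qed

text \<open>The messages of the nodes \<open>n + i\<close> are \<open>n\<close> distinct bit strings
  of length at most \<open>L\<close>; shorter strings count as well, hence
  \<open>2 ^ (L + 1)\<close> rather than \<open>2 ^ L\<close>.\<close>

lemma pls_complexity_ge:
  assumes n: "0 < n" and pls: "pls (with_max_deg n F_m) MV S"
    and mcast: "mcast 1 (with_max_deg n F_m) (snd S)"
    and L: "pls_complexity (with_max_deg n F_m) MV S \<le> enat L"
  shows "n < 2 ^ (L + 1)"
proof -
  obtain prv ver where S: "S = (prv, ver)" by (cases S)
  define C where "C = biclique n (\<lambda>v. id)"
  define m where "m i = send ver (state C (n + i)) (prv C (n + i)) 1" for i
  have CF: "C \<in> with_max_deg n F_m"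
    unfolding C_def using n by (intro biclique_in_family) auto
  have C: "MV C" "inj_on m {..<n}"
    using biclique_marks_distinct_messages[OF n pls[unfolded S]] mcast S
    by (simp_all add: C_def m_def[abs_def])
  have "length (m i) \<le> L" if "i < n" for i
  proof -
    have "enat (length (m i)) \<le> pls_complexity (with_max_deg n F_m) MV S"
      unfolding S pls_complexity_def prod.case m_def
      using CF C(1) that n
      by (intro SUP_upper2[of C] SUP_upper2[of "n + i"] SUP_upper2[of 1])
        (auto simp: C_def deg_biclique)
    then show ?thesis using L by (metis enat_ord_simps(1) order_trans)
  qed
  then have "m ` {..<n} \<subseteq> {l. length l \<le> L}" by auto
  moreover have "finite {l :: bool list. length l \<le> L}"
    using finite_lists_length_le[of "UNIV :: bool set" L] by simp
  ultimately have "card (m ` {..<n}) \<le> card {l :: bool list. length l \<le> L}"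
    by (intro card_mono)
  then show ?thesis using card_image[OF C(2)] card_lists_length_le_bool[of L] by simp
qed

lemma verification_complexity_ge:
  assumes "0 < n" "verification_complexity 1 (with_max_deg n F_m) MV \<le> enat L"
  shows "n < 2 ^ (L + 1)"
proof -
  \<comment> \<open>A strict upper bound on an infimum yields a scheme below that bound; over
    \<open>enat\<close>, being below \<open>Suc L\<close> means being at most
    \<open>L\<close>.\<close>
  have "verification_complexity 1 (with_max_deg n F_m) MV < enat (Suc L)"
    using assms(2) by (rule order_le_less_trans) simp
  then obtain S where "pls (with_max_deg n F_m) MV S" "mcast 1 (with_max_deg n F_m) (snd S)"
      "pls_complexity (with_max_deg n F_m) MV S < enat (Suc L)"
    by (auto simp: verification_complexity_def INF_less_iff)
  moreover from this have "pls_complexity (with_max_deg n F_m) MV S \<le> enat L"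
    by (cases "pls_complexity (with_max_deg n F_m) MV S") auto
  ultimately show ?thesis using pls_complexity_ge assms(1) by blast
qed

theorem theorem1:
  shows "\<exists>(a::real) (b::real) (\<Delta>\<^sub>0::nat). 0 < a \<and> 0 < b \<and>
    (\<forall>\<Delta>. ereal_of_enat (verification_complexity 1 (with_max_deg \<Delta> F_m) MV)
           \<le> ereal (b * max 1 (log 2 (real \<Delta>)))) \<and>
    (\<forall>\<Delta>\<ge>\<Delta>\<^sub>0. ereal (a * log 2 (real \<Delta>))
           \<le> ereal_of_enat (verification_complexity 1 (with_max_deg \<Delta> F_m) MV))"
proof (intro exI conjI allI impI)
  \<comment> \<open>The 3 comes from \<open>ex_colour_length\<close>; the 1/2 absorbs the off-by-one
    in \<open>log 2 \<Delta> \<le> L + 1\<close>, as \<open>L + 1 \<le> 2 * L\<close> for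
    \<open>L \<ge> 1\<close>.\<close>
  show "(0::real) < 1 / 2" "(0::real) < 3" by auto
  fix \<Delta> :: nat
  obtain k where k: "0 < k" "2 * \<Delta> < 2 ^ k" "real k \<le> 3 * max 1 (log 2 (real \<Delta>))"
    using ex_colour_length by blast
  have "ereal_of_enat (verification_complexity 1 (with_max_deg \<Delta> F_m) MV) \<le> ereal_of_enat (enat k)"
    using verification_complexity_le[OF k(2,1)] by (simp only: ereal_of_enat_le_iff)
  also have "\<dots> \<le> ereal (3 * max 1 (log 2 (real \<Delta>)))" using k(3) by simp
  finally show "ereal_of_enat (verification_complexity 1 (with_max_deg \<Delta> F_m) MV)
    \<le> ereal (3 * max 1 (log 2 (real \<Delta>)))" .
next
  fix \<Delta> :: nat assume \<Delta>: "2 \<le> \<Delta>"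
  show "ereal (1 / 2 * log 2 (real \<Delta>))
    \<le> ereal_of_enat (verification_complexity 1 (with_max_deg \<Delta> F_m) MV)"
  proof (cases "verification_complexity 1 (with_max_deg \<Delta> F_m) MV")
    case (enat L)
    then have less: "\<Delta> < 2 ^ (L + 1)" using verification_complexity_ge \<Delta> by simp
    \<comment> \<open>Here the threshold 2 enters: \<open>L = 0\<close> would give
      \<open>\<Delta> < 2\<close>.\<close>
    then have "L \<noteq> 0" using \<Delta> by (intro notI) simp
    have "real \<Delta> \<le> 2 ^ (L + 1)" using less
      by (metis less_imp_le of_nat_le_iff of_nat_numeral of_nat_power)
    also have "\<dots> = 2 powr real (L + 1)" by (rule powr_realpow[symmetric]) simp
    finally have "log 2 (real \<Delta>) \<le> real (L + 1)"
      using \<Delta> by (subst log_le_iff) simp_all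
    then have "1 / 2 * log 2 (real \<Delta>) \<le> real L" using \<open>L \<noteq> 0\<close> by simp
    then show ?thesis unfolding enat by simp
  \<comment> \<open>The remaining case is infinite complexity, which exceeds any real bound.\<close>
  qed simp
qed

end
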